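(* Let $\mathfrak g$ be a vector space, let $C^*(\mathfrak g,\mathfrak g)=\oplus_{p\ge 0}C^p(\mathfrak g,\mathfrak g)$, $C^p(\mathfrak g,\mathfrak g)=\mathrm{Hom}(\otimes^{2p+1}\mathfrak g,\mathfrak g)$, be equipped with the graded Lie bracket $\llbracket\cdot,\cdot\rrbracket$ defined in the context, and let $\mathfrak C_{\mathsf{LTS}}^*(\mathfrak g,\mathfrak g)=\oplus_{p\ge 0}\mathfrak C^p_{\mathsf{LTS}}(\mathfrak g,\mathfrak g)$ be the graded subspace defined in the context. Then $(\mathfrak C_{\mathsf{LTS}}^*(\mathfrak g,\mathfrak g),\llbracket\cdot,\cdot\rrbracket)$ is a graded Lie subalgebra of the graded Lie algebra $(C^*(\mathfrak g,\mathfrak g),\llbracket\cdot,\cdot\rrbracket)$. Moreover, its Maurer-Cartan elements (the $\pi\in\mathfrak C^1_{\mathsf{LTS}}(\mathfrak g,\mathfrak g)$ with $\llbracket\pi,\pi\rrbracket=0$) are the Lie triple system structures on the vector space $\mathfrak g$.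
   Context: **Lie triple system.** A Lie triple system is a vector space $\mathfrak g$ with a linear map $[\cdot,\cdot,\cdot]:\mathfrak g\otimes\mathfrak g\otimes\mathfrak g\to\mathfrak g$ such that for all $x,y,z,w,u\in\mathfrak g$: $[x,x,y]=0$; $[x,y,z]+[y,z,x]+[z,x,y]=0$; $[x,y,[z,w,u]]=[[x,y,z],w,u]+[z,[x,y,w],u]+[z,w,[x,y,u]]$. **The bracket.** An element of $C^p(\mathfrak g,\mathfrak g)=\mathrm{Hom}(\otimes^{2p+1}\mathfrak g,\mathfrak g)$ is regarded as a function of $p$ arguments $\mathfrak X_i=x_i\otimes y_i\in\otimes^2\mathfrak g$ and one argument $x\in\mathfrak g$; it has degree $p$. Let $\mathbb S_{(a,b)}$ be the set of $(a,b)$-shuffles, i.e. permutations $\sigma$ of $\{1,\dots,a+b\}$ with $\sigma(1)<\cdots<\sigma(a)$ and $\sigma(a+1)<\cdots<\sigma(a+b)$, and let $(-1)^\sigma$ be the sign of $\sigma$. For $P\in C^p(\mathfrak g,\mathfrak g)$, $Q\in C^q(\mathfrak g,\mathfrak g)$ put $$\llbracket P,Q\rrbracket=P\circ Q-(-1)^{pq}Q\circ P,\qquad P\circ Q=\sum_{k=1}^{p+1}(-1)^{(k-1)q}P\circ_kQ\in C^{p+q}(\mathfrak g,\mathfrak g),$$ where for $k=1,\dots,p$ $$\begin{aligned}(P\circ_kQ)(\mathfrak X_1,\dots,\mathfrak X_{p+q},x)=&\sum_{\sigma\in\mathbb S_{(k-1,q)}}(-1)^\sigma P\big(\mathfrak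 X_{\sigma(1)},\dots,\mathfrak X_{\sigma(k-1)},Q(\mathfrak X_{\sigma(k)},\dots,\mathfrak X_{\sigma(k+q-1)},x_{k+q})\otimes y_{k+q},\mathfrak X_{k+q+1},\dots,\mathfrak X_{p+q},x\big)\\&+\sum_{\sigma\in\mathbb S_{(k-1,q)}}(-1)^\sigma P\big(\mathfrak X_{\sigma(1)},\dots,\mathfrak X_{\sigma(k-1)},x_{k+q}\otimes Q(\mathfrak X_{\sigma(k)},\dots,\mathfrak X_{\sigma(k+q-1)},y_{k+q}),\mathfrak X_{k+q+1},\dots,\mathfrak X_{p+q},x\big),\end{aligned}$$ and $$(P\circ_{p+1}Q)(\mathfrak X_1,\dots,\mathfrak X_{p+q},x)=\sum_{\sigma\in\mathbb S_{(p,q)}}(-1)^\sigma P\big(\mathfrak X_{\sigma(1)},\dots,\mathfrak X_{\sigma(p)},Q(\mathfrak X_{\sigma(p+1)},\dots,\mathfrak X_{\sigma(p+q)},x)\big).$$ It is known that $(C^*(\mathfrak g,\mathfrak g),\llbracket\cdot,\cdot\rrbracket)$ is a graded Lie algebra. **The subspace.** $\mathfrak C^p_{\mathsf{LTS}}(\mathfrak g,\mathfrak g)$ is the space of $Q\in C^p(\mathfrak g,\mathfrak g)$ such that for all $\mathfrak X_i\in\otimes^2\mathfrak g$, $x,y,z\in\mathfrak g$: $$Q(\mathfrak X_1,\dots,\mathfrak X_{p-1},x,x,y)=0,$$ $$Q(\mathfrak X_1,\dots,\mathfrak X_{p-1},x,y,z)+Q(\mathfrak X_1,\dots,\mathfrak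 X_{p-1},y,z,x)+Q(\mathfrak X_1,\dots,\mathfrak X_{p-1},z,x,y)=0.$$ For $p=0$ these conditions are void and $\mathfrak C^0_{\mathsf{LTS}}(\mathfrak g,\mathfrak g)=\mathrm{Hom}(\mathfrak g,\mathfrak g)$.
   Formalization: The Maurer-Cartan claim is stated only for ground fields of characteristic different from 2; in characteristic 2 it is false, since the bracket of π with itself is 2π∘π = 0 for every π of degree 1. *)

theory Defs
  imports
    Complex_Main
    "HOL-Combinatorics.Permutations"
    "HOL-Library.Function_Algebras"
begin

(* Throughout, s is the scalar multiplication of a vector space over a field 'f whose
   underlying set is the type 'v. *)

definition lie_triple_system ::
    "('f::field \<Rightarrow> 'v::ab_group_add \<Rightarrow> 'v) \<Rightarrow> ('v \<Rightarrow> 'v \<Rightarrow> 'v \<Rightarrow> 'v) \<Rightarrow> bool" where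
  "lie_triple_system s t \<longleftrightarrow>
     (\<forall>y z. Vector_Spaces.linear s s (\<lambda>x. t x y z)) \<and>
     (\<forall>x z. Vector_Spaces.linear s s (\<lambda>y. t x y z)) \<and>
     (\<forall>x y. Vector_Spaces.linear s s (\<lambda>z. t x y z)) \<and>
     (\<forall>x y. t x x y = 0) \<and>
     (\<forall>x y z. t x y z + t y z x + t z x y = 0) \<and>
     (\<forall>x y z w u. t x y (t z w u) = t (t x y z) w u + t z (t x y w) u + t z w (t x y u))"

(* A linear map from the (2p+1)-st tensor power is encoded by the corresponding (2p+1)-linear
   map, evaluated as P [(x1,y1),...,(xp,yp)] x, where the pair (xi,yi) stands for the pure
   tensor of xi and yi. *)
type_synonym 'v cochain = "('v \<times> 'v) list \<Rightarrow> 'v \<Rightarrow> 'v"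

definition cscale :: "('f::field \<Rightarrow> 'v::ab_group_add \<Rightarrow> 'v) \<Rightarrow> 'f \<Rightarrow> 'v cochain \<Rightarrow> 'v cochain" where
  "cscale s c P = (\<lambda>Xs x. s c (P Xs x))"

(* C^p.  A p-cochain only has meaning on lists of length p; its value elsewhere is fixed to 0,
   so that equality of functions is equality of multilinear maps. *)
definition cochains :: "('f::field \<Rightarrow> 'v::ab_group_add \<Rightarrow> 'v) \<Rightarrow> nat \<Rightarrow> 'v cochain set" where
  "cochains s p = {P.
     (\<forall>Xs. length Xs = p \<longrightarrow> Vector_Spaces.linear s s (P Xs)) \<and>
     (\<forall>Xs i x. length Xs = p \<and> i < p \<longrightarrow>
        Vector_Spaces.linear s s (\<lambda>u. P (Xs[i := (u, snd (Xs ! i))]) x) \<and>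
        Vector_Spaces.linear s s (\<lambda>u. P (Xs[i := (fst (Xs ! i), u)]) x)) \<and>
     (\<forall>Xs x. length Xs \<noteq> p \<longrightarrow> P Xs x = 0)}"

definition shuffle_perms :: "nat \<Rightarrow> nat \<Rightarrow> (nat \<Rightarrow> nat) set" where
  "shuffle_perms a b = {\<sigma>. \<sigma> permutes {1..a + b} \<and>
     strict_mono_on {1..a} \<sigma> \<and> strict_mono_on {a + 1..a + b} \<sigma>}"

(* The arguments X_\<sigma>(i), ..., X_\<sigma>(j - 1).  Permutations act on 1-based
   positions, whereas list positions are 0-based. *)
definition pick :: "'a list \<Rightarrow> (nat \<Rightarrow> nat) \<Rightarrow> nat \<Rightarrow> nat \<Rightarrow> 'a list" where
  "pick Xs \<sigma> i j = map (\<lambda>m. Xs ! (\<sigma> m - 1)) [i..<j]"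

(* The partial composition of P in C^p and Q in C^q at position k in {1..p+1}. *)
definition circ_at :: "('f::field \<Rightarrow> 'v::ab_group_add \<Rightarrow> 'v) \<Rightarrow> nat \<Rightarrow> nat \<Rightarrow> nat \<Rightarrow>
    'v cochain \<Rightarrow> 'v cochain \<Rightarrow> 'v cochain" where
  "circ_at s p q k P Q = (\<lambda>Xs x.
     if k \<le> p then
       (let xk = fst (Xs ! (k + q - 1)); yk = snd (Xs ! (k + q - 1)) in
         (\<Sum>\<sigma>\<in>shuffle_perms (k - 1) q. s (of_int (sign \<sigma>))
            (P (pick Xs \<sigma> 1 k @ [(Q (pick Xs \<sigma> k (k + q)) xk, yk)] @ drop (k + q) Xs) x)) +
         (\<Sum>\<sigma>\<in>shuffle_perms (k - 1) q. s (of_int (sign \<sigma>))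
            (P (pick Xs \<sigma> 1 k @ [(xk, Q (pick Xs \<sigma> k (k + q)) yk)] @ drop (k + q) Xs) x)))
     else
       (\<Sum>\<sigma>\<in>shuffle_perms p q. s (of_int (sign \<sigma>))
          (P (pick Xs \<sigma> 1 (p + 1)) (Q (pick Xs \<sigma> (p + 1) (p + q + 1)) x))))"

definition circ :: "('f::field \<Rightarrow> 'v::ab_group_add \<Rightarrow> 'v) \<Rightarrow> nat \<Rightarrow> nat \<Rightarrow>
    'v cochain \<Rightarrow> 'v cochain \<Rightarrow> 'v cochain" where
  "circ s p q P Q = (\<lambda>Xs x.
     if length Xs = p + q
     then \<Sum>k = 1..p + 1. s ((-1) ^ ((k - 1) * q)) (circ_at s p q k P Q Xs x)
     else 0)"

definition bracket :: "('f::field \<Rightarrow> 'v::ab_group_add \<Rightarrow> 'v) \<Rightarrow> nat \<Rightarrow> nat \<Rightarrow>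
    'v cochain \<Rightarrow> 'v cochain \<Rightarrow> 'v cochain" where
  "bracket s p q P Q = circ s p q P Q - cscale s ((-1) ^ (p * q)) (circ s q p Q P)"

definition LTS_cochains :: "('f::field \<Rightarrow> 'v::ab_group_add \<Rightarrow> 'v) \<Rightarrow> nat \<Rightarrow> 'v cochain set" where
  "LTS_cochains s p = {Q \<in> cochains s p. p \<ge> 1 \<longrightarrow>
     (\<forall>Xs. length Xs = p - 1 \<longrightarrow>
        (\<forall>x y. Q (Xs @ [(x, x)]) y = 0) \<and>
        (\<forall>x y z. Q (Xs @ [(x, y)]) z + Q (Xs @ [(y, z)]) x + Q (Xs @ [(z, x)]) y = 0))}"

(* A graded vector space is given by its homogeneous components L p, and a bracket on it by
   the components br p q : L p x L q -> L (p + q).  When (L, br) is a graded Lie algebra, the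
   predicate says that M is a graded Lie subalgebra of it: graded antisymmetry and the graded
   Jacobi identity are then inherited by M. *)
definition graded_lie_subalgebra :: "('f::field \<Rightarrow> 'a::ab_group_add \<Rightarrow> 'a) \<Rightarrow>
    (nat \<Rightarrow> 'a set) \<Rightarrow> (nat \<Rightarrow> nat \<Rightarrow> 'a \<Rightarrow> 'a \<Rightarrow> 'a) \<Rightarrow> (nat \<Rightarrow> 'a set) \<Rightarrow> bool" where
  "graded_lie_subalgebra sc L br M \<longleftrightarrow>
     (\<forall>p. module.subspace sc (M p) \<and> M p \<subseteq> L p) \<and>
     (\<forall>p q. \<forall>P\<in>M p. \<forall>Q\<in>M q. br p q P Q \<in> M (p + q))"

definition maurer_cartan ::
    "(nat \<Rightarrow> 'a::ab_group_add set) \<Rightarrow> (nat \<Rightarrow> nat \<Rightarrow> 'a \<Rightarrow> 'a \<Rightarrow> 'a) \<Rightarrow> 'a set" where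
  "maurer_cartan M br = {\<pi> \<in> M 1. br 1 1 \<pi> \<pi> = 0}"

end

theory Submission
  imports Defs
begin

text \<open>
  Already \<open>P \<circ> Q\<close> stays in the subspace. Only the last pair \<open>(x, y)\<close> and the last argument \<open>z\<close> matter.
  In \<open>P \<circ>\<^sub>k Q\<close> with \<open>k < p\<close> all three are the last arguments of \<open>P\<close>, and in the terms of
  \<open>P \<circ>\<^sub>p\<^sub>+\<^sub>1 Q\<close> whose shuffle fixes \<open>p + q\<close> they are the last arguments of \<open>Q\<close>. The other terms combine,
  shuffle by shuffle, to \<open>P(\<dots>, hx, y, z) + P(\<dots>, x, hy, z) + P(\<dots>, x, y, hz)\<close> with
  \<open>h = Q(\<dots>, -)\<close>, and a derivation preserves both symmetries. In degree one
  \<open>[\<pi>, \<pi>] = 2 (\<pi> \<circ> \<pi>)\<close>, and \<open>\<pi> \<circ> \<pi> = 0\<close> is the fundamental identity.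
\<close>

section \<open>Argument lists selected by a permutation\<close>

lemma length_pick [simp]: "length (pick Xs \<sigma> i j) = j - i"
  by (simp add: pick_def)

lemma pick_cong:
  assumes "\<And>m. i \<le> m \<Longrightarrow> m < j \<Longrightarrow> Xs ! (\<sigma> m - 1) = Ys ! (\<tau> m - 1)"
  shows "pick Xs \<sigma> i j = pick Ys \<tau> i j"
  using assms by (auto simp: pick_def)

lemma pick_Suc: "i \<le> j \<Longrightarrow> pick Xs \<sigma> i (Suc j) = pick Xs \<sigma> i j @ [Xs ! (\<sigma> j - 1)]"
  by (simp add: pick_def)

lemma pick_Suc_Suc: "pick Xs \<sigma> (Suc i) (Suc j) = pick Xs (\<lambda>m. \<sigma> (Suc m)) i j"
  by (simp add: pick_def map_Suc_upt[symmetric] comp_def del: upt_Suc)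

text \<open>The permutation keeps the selected positions inside \<open>Ys\<close>. This is what
  detaches the last pair \<open>(x, y)\<close> from the arguments that are shuffled.\<close>

lemma pick_append:
  assumes "\<sigma> permutes {1..n}" "n \<le> length Ys" "1 \<le> i" "j \<le> Suc n"
  shows "pick (Ys @ Zs) \<sigma> i j = pick Ys \<sigma> i j"
proof (rule pick_cong)
  fix m assume "i \<le> m" "m < j"
  then have "\<sigma> m \<in> {1..n}" using assms permutes_in_image[OF assms(1), of m] by auto
  then have "\<sigma> m - 1 < length Ys" using assms(2) by auto
  then show "(Ys @ Zs) ! (\<sigma> m - 1) = Ys ! (\<sigma> m - 1)" by (simp add: nth_append)
qed

lemma pick_update_outside:
  assumes "\<sigma> permutes {1..n}" "n \<le> l" "1 \<le> i" "j \<le> Suc n"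
  shows "pick (Xs[l := v]) \<sigma> i j = pick Xs \<sigma> i j"
proof (rule pick_cong)
  fix m assume "i \<le> m" "m < j"
  then have "\<sigma> m \<in> {1..n}" using assms permutes_in_image[OF assms(1), of m] by auto
  then have "\<sigma> m - 1 \<noteq> l" using assms(2) by auto
  then show "Xs[l := v] ! (\<sigma> m - 1) = Xs ! (\<sigma> m - 1)" by simp
qed

text \<open>The entry at 0-based position \<open>l\<close> is argument number \<open>Suc l\<close>,
  and a permutation selects it exactly once, at \<open>inv \<sigma> (Suc l)\<close>. Hence changing
  one argument changes at most one entry of the selection, which gives linearity slot by
  slot.\<close>

lemma pick_update:
  assumes \<sigma>: "\<sigma> permutes {1..n}" and "n \<le> length Xs" "l < n" "1 \<le> i" "j \<le> Suc n"
  shows "pick (Xs[l := v]) \<sigma> i j =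
    (if inv \<sigma> (Suc l) \<in> {i..<j} then (pick Xs \<sigma> i j)[inv \<sigma> (Suc l) - i := v] else pick Xs \<sigma> i j)"
proof (rule nth_equalityI)
  fix a assume "a < length (pick (Xs[l := v]) \<sigma> i j)"
  then have a: "i + a < j" by simp
  then have "\<sigma> (i + a) \<in> {1..n}" using assms permutes_in_image[OF \<sigma>, of "i + a"] by auto
  then have "\<sigma> (i + a) - 1 = l \<longleftrightarrow> \<sigma> (i + a) = Suc l" by auto
  also have "\<dots> \<longleftrightarrow> i + a = inv \<sigma> (Suc l)"
    using permutes_inv_eq[OF \<sigma>] by metis
  finally show "pick (Xs[l := v]) \<sigma> i j ! a =
    (if inv \<sigma> (Suc l) \<in> {i..<j} then (pick Xs \<sigma> i j)[inv \<sigma> (Suc l) - i := v] else pick Xs \<sigma> i j) ! a"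
    using a assms by (auto simp: pick_def nth_list_update)
qed auto

section \<open>Shuffles and the position of their maximum\<close>

lemma shuffle_perms_permutes: "\<sigma> \<in> shuffle_perms a b \<Longrightarrow> \<sigma> permutes {1..a + b}"
  by (simp add: shuffle_perms_def)

lemma finite_shuffle_perms: "finite (shuffle_perms a b)"
  by (rule finite_subset[OF _ finite_permutations[of "{1..a + b}"]]) (auto simp: shuffle_perms_def)

text \<open>Since a shuffle increases on each block, the maximum \<open>a + b\<close> can be
  attained only at the end of a block, that is at \<open>a\<close> or at
  \<open>a + b\<close>.\<close>

lemma shuffle_perms_last:
  assumes "\<sigma> \<in> shuffle_perms a b" "a + b \<ge> 1" "\<sigma> a \<noteq> a + b"
  shows "b \<ge> 1" "\<sigma> (a + b) = a + b"
proof -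
  have \<sigma>: "\<sigma> permutes {1..a + b}" "strict_mono_on {1..a} \<sigma>" "strict_mono_on {a + 1..a + b} \<sigma>"
    using assms(1) by (auto simp: shuffle_perms_def)
  obtain m where m: "m \<in> {1..a + b}" "\<sigma> m = a + b"
    using permutes_image[OF \<sigma>(1)] assms(2) by (metis atLeastAtMost_iff imageE order_refl)
  have bound: "\<sigma> j \<le> a + b" if "j \<in> {1..a + b}" for j
    using permutes_in_image[OF \<sigma>(1), of j] that by auto
  have "\<not> m < a"
    using strict_mono_onD[OF \<sigma>(2), of m a] m bound[of a] by auto
  moreover have "m \<noteq> a" using m assms by auto
  ultimately have "m > a" by simp
  moreover have "\<not> (a < m \<and> m < a + b)"
    using strict_mono_onD[OF \<sigma>(3), of m "a + b"] m bound[of "a + b"] by auto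
  ultimately have "m = a + b" "b \<ge> 1" using m by auto
  then show "b \<ge> 1" "\<sigma> (a + b) = a + b" using m by auto
qed

text \<open>The cycle of length \<open>b + 1\<close> that sends \<open>a\<close> to the top
  \<open>a + b\<close> and moves every later position down by one. Composing with it on the right
  inserts the maximum at position \<open>a\<close> of a shuffle.\<close>

definition shift_cycle :: "nat \<Rightarrow> nat \<Rightarrow> nat \<Rightarrow> nat" where
  "shift_cycle a b m = (if m = a then a + b else if a < m \<and> m \<le> a + b then m - 1 else m)"

text \<open>Building the cycle from adjacent transpositions yields both its support and its sign by
  induction.\<close>

lemma shift_cycle_Suc: "shift_cycle a (Suc b) = transpose (a + b) (a + Suc b) \<circ> shift_cycle a b"
  by (auto simp: fun_eq_iff shift_cycle_def transpose_def)

lemma shift_cycle_permutes: "shift_cycle a b permutes {a..a + b}"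
proof (induction b)
  case 0
  then show ?case by (auto simp: permutes_def shift_cycle_def)
next
  case (Suc b)
  have "shift_cycle a b permutes {a..a + Suc b}"
    using Suc by (rule permutes_subset) auto
  then show ?case unfolding shift_cycle_Suc
    by (rule permutes_compose) (auto intro: permutes_swap_id)
qed

lemma sign_shift_cycle: "sign (shift_cycle a b) = (-1) ^ b"
proof (induction b)
  case 0
  have "shift_cycle a 0 = id" by (auto simp: shift_cycle_def)
  then show ?case by simp
next
  case (Suc b)
  have "permutation (shift_cycle a b)"
    using shift_cycle_permutes by (rule permutation_permutes[THEN iffD2, OF exI, OF conjI, rotated]) simp
  then show ?case unfolding shift_cycle_Suc
    by (subst sign_compose) (auto simp: permutation_swap_id sign_swap_id Suc)
qed

text \<open>
  A shuffle of \<open>p + 1\<close> and \<open>q\<close> items whose first block ends in the maximum is a shuffle of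
  \<open>p\<close> and \<open>q\<close> items with that maximum inserted.
\<close>

lemma bij_betw_shuffle_perms:
  "bij_betw (\<lambda>\<tau>. \<tau> \<circ> shift_cycle (Suc p) q) (shuffle_perms p q)
     {\<sigma> \<in> shuffle_perms (Suc p) q. \<sigma> (Suc p) = Suc p + q}"
proof -
  define c where "c = shift_cycle (Suc p) q"
  have c: "c permutes {1..Suc (p + q)}"
    unfolding c_def by (rule permutes_subset[OF shift_cycle_permutes]) auto
  have c_top: "c (Suc p) = Suc (p + q)"
    and c_le: "m \<le> p \<Longrightarrow> c m = m"
    and c_gt: "p + 2 \<le> m \<Longrightarrow> m \<le> Suc (p + q) \<Longrightarrow> c m = m - 1" for m
    by (auto simp: c_def shift_cycle_def)
  have 1: "\<tau> \<circ> c \<in> shuffle_perms (Suc p) q \<and> (\<tau> \<circ> c) (Suc p) = Suc p + q"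
    if "\<tau> \<in> shuffle_perms p q" for \<tau>
  proof -
    have \<tau>: "\<tau> permutes {1..p + q}" "strict_mono_on {1..p} \<tau>" "strict_mono_on {p + 1..p + q} \<tau>"
      using that by (auto simp: shuffle_perms_def)
    have "\<tau> permutes {1..Suc (p + q)}" by (rule permutes_subset[OF \<tau>(1)]) auto
    with c have "\<tau> \<circ> c permutes {1..Suc (p + q)}" by (rule permutes_compose)
    moreover have top: "\<tau> (Suc (p + q)) = Suc (p + q)"
      using \<tau>(1) by (auto simp: permutes_def)
    moreover have "strict_mono_on {1..Suc p} (\<tau> \<circ> c)"
    proof (rule strict_mono_onI)
      fix r s assume rs: "r \<in> {1..Suc p}" "s \<in> {1..Suc p}" "r < s"
      have "\<tau> r \<in> {1..p + q}" using rs permutes_in_image[OF \<tau>(1), of r] by auto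
      then show "(\<tau> \<circ> c) r < (\<tau> \<circ> c) s"
        using rs c_top c_le[of r] c_le[of s] top strict_mono_onD[OF \<tau>(2), of r s]
        by (cases "s = Suc p") auto
    qed
    moreover have "strict_mono_on {Suc p + 1..Suc p + q} (\<tau> \<circ> c)"
    proof (rule strict_mono_onI)
      fix r s assume "r \<in> {Suc p + 1..Suc p + q}" "s \<in> {Suc p + 1..Suc p + q}" "r < s"
      then show "(\<tau> \<circ> c) r < (\<tau> \<circ> c) s"
        using c_gt[of r] c_gt[of s] by (auto intro!: strict_mono_onD[OF \<tau>(3)])
    qed
    ultimately show ?thesis using c_top by (simp add: shuffle_perms_def)
  qed
  have 2: "\<sigma> \<circ> inv c \<in> shuffle_perms p q"
    if \<sigma>_in: "\<sigma> \<in> shuffle_perms (Suc p) q" and \<sigma>_top: "\<sigma> (Suc p) = Suc p + q" for \<sigma>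
  proof -
    have \<sigma>: "\<sigma> permutes {1..Suc (p + q)}" "strict_mono_on {1..Suc p} \<sigma>"
        "strict_mono_on {Suc p + 1..Suc p + q} \<sigma>"
      using \<sigma>_in by (auto simp: shuffle_perms_def)
    have ic_top: "inv c (Suc (p + q)) = Suc p"
      and ic_le: "m \<le> p \<Longrightarrow> inv c m = m"
      and ic_gt: "p + 1 \<le> m \<Longrightarrow> m \<le> p + q \<Longrightarrow> inv c m = Suc m" for m
      using c_top c_le[of m] c_gt[of "Suc m"] by (auto simp: permutes_inv_eq[OF c])
    have perm: "\<sigma> \<circ> inv c permutes {1..Suc (p + q)}"
      using permutes_inv[OF c] \<sigma>(1) by (rule permutes_compose)
    \<comment> \<open>The top is a fixed point: \<open>inv c\<close> takes it to
      \<open>Suc p\<close>, where \<open>\<sigma>\<close> attains its maximum.\<close>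
    have "\<sigma> \<circ> inv c permutes {1..p + q}"
    proof (rule permutes_superset[OF perm])
      fix x assume "x \<in> {1..Suc (p + q)} - {1..p + q}"
      then have "x = Suc (p + q)" by auto
      then show "(\<sigma> \<circ> inv c) x = x" using ic_top \<sigma>_top by simp
    qed
    moreover have "strict_mono_on {1..p} (\<sigma> \<circ> inv c)"
      using strict_mono_onD[OF \<sigma>(2)] by (intro strict_mono_onI) (simp add: ic_le)
    moreover have "strict_mono_on {p + 1..p + q} (\<sigma> \<circ> inv c)"
      using strict_mono_onD[OF \<sigma>(3)] by (intro strict_mono_onI) (simp add: ic_gt)
    ultimately show ?thesis by (simp add: shuffle_perms_def)
  qed
  have cc: "c \<circ> inv c = id" "inv c \<circ> c = id" using permutes_inv_o[OF c] by auto
  show ?thesis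
    unfolding c_def[symmetric]
    by (rule bij_betw_byWitness[where f' = "\<lambda>\<sigma>. \<sigma> \<circ> inv c"])
      (use 1 2 in \<open>auto simp: comp_assoc cc\<close>)
qed

lemma sign_comp_shift_cycle:
  assumes "\<tau> \<in> shuffle_perms p q"
  shows "sign (\<tau> \<circ> shift_cycle a b) = sign \<tau> * (-1) ^ b"
proof -
  have "permutation \<tau>" "permutation (shift_cycle a b)"
    using shuffle_perms_permutes[OF assms] shift_cycle_permutes[of a b]
    by (auto simp: permutation_permutes)
  then show ?thesis by (simp add: sign_compose sign_shift_cycle)
qed

section \<open>The two symmetries of a ternary map\<close>

definition lts_symmetric :: "('v::ab_group_add \<Rightarrow> 'v \<Rightarrow> 'v \<Rightarrow> 'v) \<Rightarrow> bool" where
  "lts_symmetric T \<longleftrightarrow> (\<forall>x y. T x x y = 0) \<and> (\<forall>x y z. T x y z + T y z x + T z x y = 0)"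

lemma lts_symmetric_zero: "lts_symmetric (\<lambda>x y z. 0)"
  by (simp add: lts_symmetric_def)

lemma lts_symmetric_plus:
  assumes "lts_symmetric T" "lts_symmetric U"
  shows "lts_symmetric (\<lambda>x y z. T x y z + U x y z)"
  unfolding lts_symmetric_def
proof (intro conjI allI)
  fix x y z
  have "T x y z + U x y z + (T y z x + U y z x) + (T z x y + U z x y) =
    (T x y z + T y z x + T z x y) + (U x y z + U y z x + U z x y)"
    by (simp add: algebra_simps)
  then show "T x y z + U x y z + (T y z x + U y z x) + (T z x y + U z x y) = 0"
    using assms by (simp only: lts_symmetric_def add_0)
qed (use assms in \<open>simp add: lts_symmetric_def\<close>)

lemma lts_symmetric_sum:
  "(\<And>i. i \<in> I \<Longrightarrow> lts_symmetric (T i)) \<Longrightarrow> lts_symmetric (\<lambda>x y z. \<Sum>i\<in>I. T i x y z)"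
  by (induction I rule: infinite_finite_induct) (auto simp: lts_symmetric_zero lts_symmetric_plus)

text \<open>The nine terms of the cyclic sum regroup into three cyclic sums of \<open>T\<close>,
  over the triples \<open>(h x, y, z)\<close>, \<open>(x, h y, z)\<close> and
  \<open>(x, y, h z)\<close>. On equal first arguments, the first two terms cancel by
  skew-symmetry.\<close>

lemma lts_symmetric_derivation:
  assumes "lts_symmetric T"
    and add1: "\<And>x x' y z. T (x + x') y z = T x y z + T x' y z"
    and add2: "\<And>x y y' z. T x (y + y') z = T x y z + T x y' z"
  shows "lts_symmetric (\<lambda>x y z. T (h x) y z + T x (h y) z + T x y (h z))"
proof -
  have alt: "T x x z = 0" and cyc: "T x y z + T y z x + T z x y = 0" for x y z
    using assms(1) by (auto simp: lts_symmetric_def)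
  \<comment> \<open>Polarization: expand the alternating law at \<open>x + y\<close>.\<close>
  have "T x y z + T y x z = 0" for x y z
    using alt[of "x + y" z, unfolded add1 add2] alt[of x z] alt[of y z] by (simp add: add.commute)
  moreover have "T (h x) y z + T x (h y) z + T x y (h z) + (T (h y) z x + T y (h z) x + T y z (h x)) +
      (T (h z) x y + T z (h x) y + T z x (h y)) =
    (T (h x) y z + T y z (h x) + T z (h x) y) + (T x (h y) z + T (h y) z x + T z x (h y)) +
    (T x y (h z) + T y (h z) x + T (h z) x y)" for x y z
    by (simp add: algebra_simps)
  ultimately show ?thesis
    by (simp add: lts_symmetric_def cyc alt)
qed

section \<open>Multilinearity of cochains and of their composition\<close>

locale cochain_space = vector_space scale
  for scale :: "'f::field \<Rightarrow> 'v::ab_group_add \<Rightarrow> 'v"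
begin

abbreviation lin :: "('v \<Rightarrow> 'v) \<Rightarrow> bool" where
  "lin f \<equiv> Vector_Spaces.linear scale scale f"

lemma lin_iff: "lin f \<longleftrightarrow> (\<forall>x y. f (x + y) = f x + f y) \<and> (\<forall>c x. f (scale c x) = scale c (f x))"
  by (simp add: Vector_Spaces.linear_def module_hom_def module_hom_axioms_def module_axioms
      vector_space_axioms vector_space_def[symmetric])

lemma lin_add: "lin f \<Longrightarrow> f (x + y) = f x + f y"
  by (simp add: lin_iff)

lemma lin_zero: "lin f \<Longrightarrow> f 0 = 0"
  using lin_add[of f 0 0] by simp

lemma lin_compose: "lin f \<Longrightarrow> lin g \<Longrightarrow> lin (\<lambda>x. f (g x))"
  by (simp add: lin_iff)

lemma lin_const_zero: "lin (\<lambda>x. 0)"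
  by (simp add: lin_iff)

lemma lin_plus: "lin f \<Longrightarrow> lin g \<Longrightarrow> lin (\<lambda>x. f x + g x)"
  by (simp add: lin_iff scale_right_distrib)

lemma lin_scale: "lin f \<Longrightarrow> lin (\<lambda>x. scale c (f x))"
  by (simp add: lin_iff scale_right_distrib mult.commute)

lemma lin_sum: "(\<And>i. i \<in> I \<Longrightarrow> lin (f i)) \<Longrightarrow> lin (\<lambda>x. \<Sum>i\<in>I. f i x)"
  by (induction I rule: infinite_finite_induct) (auto simp: lin_const_zero lin_plus)

text \<open>The two ways of placing a variable vector in a pair whose other component is fixed.
  Linearity in the \<open>x\<close> and in the \<open>y\<close> of a pair thereby becomes one
  statement.\<close>

definition slots :: "('v \<Rightarrow> 'v \<times> 'v) set" where
  "slots = range (\<lambda>y u. (u, y)) \<union> range (\<lambda>x u. (x, u))"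

lemma slots_fst: "(\<lambda>u. (u, y)) \<in> slots" and slots_snd: "(\<lambda>u. (x, u)) \<in> slots"
  by (auto simp: slots_def)

lemma cochains_lin: "P \<in> cochains scale p \<Longrightarrow> length Xs = p \<Longrightarrow> lin (P Xs)"
  by (simp add: cochains_def)

lemma cochains_outside: "P \<in> cochains scale p \<Longrightarrow> length Xs \<noteq> p \<Longrightarrow> P Xs x = 0"
  by (simp add: cochains_def)

lemma cochains_lin_slot:
  assumes "P \<in> cochains scale p" "length Xs = p" "i < p" "f \<in> slots"
  shows "lin (\<lambda>u. P (Xs[i := f u]) x)"
proof -
  have *: "\<And>Xs. length Xs = p \<Longrightarrow> lin (\<lambda>u. P (Xs[i := (u, snd (Xs ! i))]) x) \<and>
    lin (\<lambda>u. P (Xs[i := (fst (Xs ! i), u)]) x)"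
    using assms by (auto simp: cochains_def)
  from \<open>f \<in> slots\<close> obtain y where "f = (\<lambda>u. (u, y)) \<or> f = (\<lambda>u. (y, u))"
    by (auto simp: slots_def)
  then show ?thesis
    \<comment> \<open>Putting \<open>(y, y)\<close> at position \<open>i\<close> makes either fixed
      component equal to \<open>y\<close>; the second update then overwrites this entry.\<close>
    using *[of "Xs[i := (y, y)]"] assms by auto
qed

lemma cochains_lin_middle:
  assumes "P \<in> cochains scale p" "length A + Suc (length B) = p" "f \<in> slots"
  shows "lin (\<lambda>u. P (A @ f u # B) x)"
  \<comment> \<open>The entry \<open>undefined\<close> is only a placeholder, overwritten by the
    update.\<close>
  using cochains_lin_slot[OF assms(1), of "A @ undefined # B" "length A" f x] assms
  by simp

lemma cochainsI:
  assumes "\<And>Xs. length Xs = p \<Longrightarrow> lin (P Xs)"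
    and "\<And>Xs i x f. length Xs = p \<Longrightarrow> i < p \<Longrightarrow> f \<in> slots \<Longrightarrow> lin (\<lambda>u. P (Xs[i := f u]) x)"
    and "\<And>Xs x. length Xs \<noteq> p \<Longrightarrow> P Xs x = 0"
  shows "P \<in> cochains scale p"
  using assms by (auto simp: cochains_def slots_fst slots_snd)

text \<open>The varied argument is shuffled (into \<open>P\<close> or into \<open>Q\<close>), is the
  pair on which \<open>Q\<close> acts, or comes after that pair. The choice of \<open>act\<close>
  covers the two sums in the definition of the partial composition.\<close>

lemma lin_inner:
  fixes x :: 'v
  assumes P: "P \<in> cochains scale p" and Q: "Q \<in> cochains scale q"
    and k: "1 \<le> k" "k \<le> p" and \<sigma>: "\<sigma> \<in> shuffle_perms (k - 1) q"
    and Xs: "length Xs = p + q" and i: "i < p + q" and f: "f \<in> slots"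
    and act: "act = apfst \<or> act = apsnd"
  defines "T \<equiv> \<lambda>Xs. P (pick Xs \<sigma> 1 k @ act (Q (pick Xs \<sigma> k (k + q))) (Xs ! (k + q - 1)) #
    drop (k + q) Xs) x"
  shows "lin (\<lambda>u. T (Xs[i := f u]))"
proof -
  define A where "A = pick Xs \<sigma> 1 k"
  define B where "B = pick Xs \<sigma> k (k + q)"
  define D where "D = drop (k + q) Xs"
  define X where "X = Xs ! (k + q - 1)"
  note defs = A_def[symmetric] B_def[symmetric] D_def[symmetric] X_def[symmetric]
  have len: "length A = k - 1" "length B = q" "length D = p - k"
    using Xs by (auto simp: A_def B_def D_def)
  have perm: "\<sigma> permutes {1..k + q - 1}"
    using shuffle_perms_permutes[OF \<sigma>] k by simp
  consider "i < k + q - 1" | "i = k + q - 1" | "i > k + q - 1" by linarith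
  then show ?thesis
  proof cases
    case 1
    \<comment> \<open>The place to which the shuffle brings the varied argument: before
      \<open>k\<close> it is an argument of \<open>P\<close>, otherwise of \<open>Q\<close>.\<close>
    define m where "m = inv \<sigma> (Suc i)"
    have m: "m \<in> {1..k + q - 1}"
      using permutes_in_image[OF permutes_inv[OF perm], of "Suc i"] 1 by (auto simp: m_def)
    have pickA: "pick (Xs[i := f u]) \<sigma> 1 k = (if m < k then A[m - 1 := f u] else A)" for u
      using m pick_update[OF perm, of Xs i 1 k "f u"] 1 Xs k by (auto simp: A_def m_def)
    have pickB: "pick (Xs[i := f u]) \<sigma> k (k + q) = (if m < k then B else B[m - k := f u])" for u
      using m pick_update[OF perm, of Xs i k "k + q" "f u"] 1 Xs k by (auto simp: B_def m_def)
    have T: "T (Xs[i := f u]) =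
      P ((if m < k then A[m - 1 := f u] else A) @ act (Q (if m < k then B else B[m - k := f u])) X # D) x" for u
      using 1 by (simp add: T_def pickA pickB X_def D_def del: One_nat_def)
    show ?thesis
    proof (cases "m < k")
      case True
      then have "m - 1 < length A" using m len by auto
      then show ?thesis
        using True cochains_lin_slot[OF P, of "A @ act (Q B) X # D" "m - 1" f x] len k f
        by (simp add: T list_update_append1)
    next
      case False
      have "lin (\<lambda>u. Q (B[m - k := f u]) y)" for y
        using cochains_lin_slot[OF Q, of B "m - k" f] m False len f k by auto
      moreover have "lin (\<lambda>u. P (A @ g u # D) x)" if "g \<in> slots" for g
        using cochains_lin_middle[OF P, of A D g x] that len k by simp
      ultimately show ?thesis
        using act lin_compose[OF _ \<open>lin (\<lambda>u. Q (B[m - k := f u]) (fst X))\<close>, of "\<lambda>u. P (A @ (u, snd X) # D) x"]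
          lin_compose[OF _ \<open>lin (\<lambda>u. Q (B[m - k := f u]) (snd X))\<close>, of "\<lambda>u. P (A @ (fst X, u) # D) x"]
        by (cases X) (auto simp: T False slots_fst slots_snd)
    qed
  next
    case 2
    have "pick (Xs[i := v]) \<sigma> 1 k = A" "pick (Xs[i := v]) \<sigma> k (k + q) = B" for v
      unfolding A_def B_def using 2 k by (auto intro!: pick_update_outside[OF perm])
    then have T: "T (Xs[i := f u]) = P (A @ act (Q B) (f u) # D) x" for u
      using 2 k Xs by (simp add: T_def D_def del: One_nat_def)
    have lin_Q: "lin (Q B)" using cochains_lin[OF Q] len by simp
    have lin_P: "lin (\<lambda>u. P (A @ g u # D) x)" if "g \<in> slots" for g
      using cochains_lin_middle[OF P, of A D g x] that len k by simp
    obtain y where "f = (\<lambda>u. (u, y)) \<or> f = (\<lambda>u. (y, u))"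
      using f by (auto simp: slots_def)
    then show ?thesis
      using act lin_P[OF slots_fst] lin_P[OF slots_snd] lin_compose[OF lin_P[OF slots_fst] lin_Q]
        lin_compose[OF lin_P[OF slots_snd] lin_Q] by (auto simp: T)
  next
    case 3
    have "pick (Xs[i := v]) \<sigma> 1 k = A" "pick (Xs[i := v]) \<sigma> k (k + q) = B" for v
      unfolding A_def B_def using 3 k by (auto intro!: pick_update_outside[OF perm])
    then have "T (Xs[i := f u]) = P (A @ act (Q B) X # D[i - (k + q) := f u]) x" for u
      using 3 k Xs by (simp add: T_def D_def X_def drop_update_swap del: One_nat_def)
    moreover have "i - q = length A + Suc (i - (k + q))" using 3 k len by simp
    then have "(A @ w # D)[i - q := v] = A @ w # D[i - (k + q) := v]" for w v
      by (simp add: list_update_append)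
    ultimately show ?thesis
      using cochains_lin_slot[OF P, of "A @ act (Q B) X # D" "i - q" f x] 3 k i len f by simp
  qed
qed

text \<open>Here every pair is shuffled, so the varied one is an argument either of \<open>P\<close>
  or of \<open>Q\<close>.\<close>

lemma lin_outer:
  assumes P: "P \<in> cochains scale p" and Q: "Q \<in> cochains scale q"
    and \<sigma>: "\<sigma> \<in> shuffle_perms p q"
    and Xs: "length Xs = p + q" and i: "i < p + q" and f: "f \<in> slots"
  shows "lin (\<lambda>u. P (pick (Xs[i := f u]) \<sigma> 1 (p + 1)) (Q (pick (Xs[i := f u]) \<sigma> (p + 1) (p + q + 1)) x))"
proof -
  define A where "A = pick Xs \<sigma> 1 (p + 1)"
  define B where "B = pick Xs \<sigma> (p + 1) (p + q + 1)"
  have len: "length A = p" "length B = q" by (auto simp: A_def B_def)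
  have perm: "\<sigma> permutes {1..p + q}"
    using shuffle_perms_permutes[OF \<sigma>] .
  define m where "m = inv \<sigma> (Suc i)"
  have m: "m \<in> {1..p + q}"
    using permutes_in_image[OF permutes_inv[OF perm], of "Suc i"] i by (auto simp: m_def)
  have pickA: "pick (Xs[i := f u]) \<sigma> 1 (p + 1) = (if m \<le> p then A[m - 1 := f u] else A)" for u
    using m pick_update[OF perm, of Xs i 1 "p + 1" "f u"] Xs i by (auto simp: A_def m_def)
  have pickB: "pick (Xs[i := f u]) \<sigma> (p + 1) (p + q + 1) =
      (if m \<le> p then B else B[m - (p + 1) := f u])" for u
    using m pick_update[OF perm, of Xs i "p + 1" "p + q + 1" "f u"] Xs i by (auto simp: B_def m_def)
  show ?thesis
  proof (cases "m \<le> p")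
    case True
    then show ?thesis unfolding pickA pickB
      using cochains_lin_slot[OF P, of A "m - 1" f] len m f by simp
  next
    case False
    have "lin (\<lambda>u. Q (B[m - (p + 1) := f u]) x)"
      using cochains_lin_slot[OF Q] len m f False by simp
    then show ?thesis unfolding pickA pickB
      using lin_compose[OF cochains_lin[OF P, of A]] len False by simp
  qed
qed

text \<open>Merging the two sums shuffle by shuffle exhibits the first two terms of a
  derivation.\<close>

lemma circ_at_inner: "k \<le> p \<Longrightarrow> circ_at scale p q k P Q Xs x =
   (\<Sum>\<sigma>\<in>shuffle_perms (k - 1) q. scale (of_int (sign \<sigma>))
      (P (pick Xs \<sigma> 1 k @ apfst (Q (pick Xs \<sigma> k (k + q))) (Xs ! (k + q - 1)) # drop (k + q) Xs) x +
       P (pick Xs \<sigma> 1 k @ apsnd (Q (pick Xs \<sigma> k (k + q))) (Xs ! (k + q - 1)) # drop (k + q) Xs) x))"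
  by (cases "Xs ! (k + q - 1)") (simp add: circ_at_def Let_def scale_right_distrib sum.distrib)

lemma circ_at_outer: "circ_at scale p q (Suc p) P Q Xs x =
   (\<Sum>\<sigma>\<in>shuffle_perms p q. scale (of_int (sign \<sigma>))
      (P (pick Xs \<sigma> 1 (p + 1)) (Q (pick Xs \<sigma> (p + 1) (p + q + 1)) x)))"
  by (simp add: circ_at_def)

lemma circ_in_cochains:
  assumes P: "P \<in> cochains scale p" and Q: "Q \<in> cochains scale q"
  shows "circ scale p q P Q \<in> cochains scale (p + q)"
proof (rule cochainsI)
  fix Xs :: "('v \<times> 'v) list" assume Xs: "length Xs = p + q"
  have "lin (\<lambda>x. circ_at scale p q k P Q Xs x)" if k: "k \<in> {1..p + 1}" for k
  proof (cases "k \<le> p")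
    case True
    then show ?thesis unfolding circ_at_inner[OF True]
      using k Xs by (intro lin_sum lin_scale lin_plus cochains_lin[OF P]) auto
  next
    case False
    then have "k = Suc p" using k by simp
    then show ?thesis unfolding circ_at_outer
      by (auto intro!: lin_sum lin_scale lin_compose[OF cochains_lin[OF P]] cochains_lin[OF Q]
        simp: circ_at_outer)
  qed
  then show "lin (circ scale p q P Q Xs)"
    unfolding circ_def using Xs by (auto simp del: sum.cl_ivl_Suc intro!: lin_sum lin_scale)
next
  fix Xs :: "('v \<times> 'v) list" and i x f
  assume Xs: "length Xs = p + q" and i: "i < p + q" and f: "f \<in> slots"
  have "lin (\<lambda>u. circ_at scale p q k P Q (Xs[i := f u]) x)" if k: "k \<in> {1..p + 1}" for k
  proof (cases "k \<le> p")
    case True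
    then show ?thesis unfolding circ_at_inner[OF True]
      using k by (intro lin_sum lin_scale lin_plus lin_inner[OF P Q _ _ _ Xs i f]) auto
  next
    case False
    then have "k = Suc p" using k by simp
    then show ?thesis
      using lin_outer[OF P Q _ Xs i f] by (simp only: circ_at_outer) (intro lin_sum lin_scale)
  qed
  then show "lin (\<lambda>u. circ scale p q P Q (Xs[i := f u]) x)"
    unfolding circ_def using Xs by (auto simp del: sum.cl_ivl_Suc intro!: lin_sum lin_scale)
qed (simp add: circ_def)

section \<open>Closure of the subspace under composition\<close>

lemma lts_symmetric_lin:
  assumes "lin h" "lts_symmetric T"
  shows "lts_symmetric (\<lambda>x y z. h (T x y z))"
  using assms(2) unfolding lts_symmetric_def
  by (metis lin_add[OF assms(1)] lin_zero[OF assms(1)])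

lemma lts_symmetric_scale: "lts_symmetric T \<Longrightarrow> lts_symmetric (\<lambda>x y z. scale c (T x y z))"
  by (rule lts_symmetric_lin) (simp_all add: lin_iff scale_right_distrib mult.commute)

lemma LTS_cochains_iff:
  "Q \<in> LTS_cochains scale p \<longleftrightarrow> Q \<in> cochains scale p \<and>
     (\<forall>Xs. p = Suc (length Xs) \<longrightarrow> lts_symmetric (\<lambda>x y z. Q (Xs @ [(x, y)]) z))"
  unfolding LTS_cochains_def lts_symmetric_def by (cases p) auto

lemma LTS_cochains_symmetric:
  "Q \<in> LTS_cochains scale p \<Longrightarrow> p = Suc (length Xs) \<Longrightarrow> lts_symmetric (\<lambda>x y z. Q (Xs @ [(x, y)]) z)"
  by (simp add: LTS_cochains_iff)

text \<open>For \<open>k < p\<close> the pair on which \<open>Q\<close> acts lies inside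
  \<open>Ys\<close>, so \<open>(x, y)\<close> and \<open>z\<close> reach the end of \<open>P\<close>
  untouched and the symmetry of \<open>P\<close> applies to each summand.\<close>

lemma lts_symmetric_circ_at_inner:
  assumes P: "P \<in> LTS_cochains scale p" and k: "1 \<le> k" "k < p" and Ys: "p + q = Suc (length Ys)"
  shows "lts_symmetric (\<lambda>x y z. circ_at scale p q k P Q (Ys @ [(x, y)]) z)"
proof -
  have picks: "pick (Ys @ Z) \<sigma> 1 k = pick Ys \<sigma> 1 k" "pick (Ys @ Z) \<sigma> k (k + q) = pick Ys \<sigma> k (k + q)"
    if "\<sigma> \<in> shuffle_perms (k - 1) q" for \<sigma> Z
    using k Ys by (auto intro!: pick_append[OF shuffle_perms_permutes[OF that]])
  have rest: "(Ys @ Z) ! (k + q - 1) = Ys ! (k + q - 1)" "drop (k + q) (Ys @ Z) = drop (k + q) Ys @ Z" for Z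
    using k Ys by (auto simp: nth_append)
  have P_sym: "lts_symmetric (\<lambda>x y z. P (pick Ys \<sigma> 1 k @ w # drop (k + q) Ys @ [(x, y)]) z)" for \<sigma> w
    using LTS_cochains_symmetric[OF P, of "pick Ys \<sigma> 1 k @ w # drop (k + q) Ys"] k Ys by simp
  have "circ_at scale p q k P Q (Ys @ [v]) z = (\<Sum>\<sigma>\<in>shuffle_perms (k - 1) q. scale (of_int (sign \<sigma>))
      (P (pick Ys \<sigma> 1 k @ apfst (Q (pick Ys \<sigma> k (k + q))) (Ys ! (k + q - 1)) # drop (k + q) Ys @ [v]) z +
       P (pick Ys \<sigma> 1 k @ apsnd (Q (pick Ys \<sigma> k (k + q))) (Ys ! (k + q - 1)) # drop (k + q) Ys @ [v]) z))" for v z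
    unfolding circ_at_inner[OF less_imp_le[OF k(2)]] rest
    by (rule sum.cong[OF refl]) (simp only: picks)
  then show ?thesis
    by (simp only:) (intro lts_symmetric_sum lts_symmetric_scale lts_symmetric_plus P_sym)
qed

text \<open>The shuffle must fix \<open>p + q\<close>, so \<open>(x, y)\<close> is the last pair of
  \<open>Q\<close> and \<open>z\<close> its last argument. The symmetry of \<open>Q\<close> survives
  the linear map given by \<open>P\<close> with its pairs fixed.\<close>

lemma lts_symmetric_circ_at_outer:
  assumes P: "P \<in> cochains scale p" and Q: "Q \<in> LTS_cochains scale q"
    and Ys: "p + q = Suc (length Ys)" and \<sigma>: "\<sigma> \<in> shuffle_perms p q" "\<sigma> p \<noteq> p + q"
  shows "lts_symmetric (\<lambda>x y z. P (pick (Ys @ [(x, y)]) \<sigma> 1 (p + 1))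
    (Q (pick (Ys @ [(x, y)]) \<sigma> (p + 1) (p + q + 1)) z))"
proof -
  have q: "q \<ge> 1" and top: "\<sigma> (p + q) = p + q"
    using shuffle_perms_last[OF \<sigma>(1) _ \<sigma>(2)] Ys by auto
  have perm: "\<sigma> permutes {1..length Ys}"
  proof (rule permutes_superset[OF shuffle_perms_permutes[OF \<sigma>(1)]])
    fix m assume "m \<in> {1..p + q} - {1..length Ys}"
    then have "m = p + q" using Ys by auto
    then show "\<sigma> m = m" using top by simp
  qed
  have 1: "pick (Ys @ Z) \<sigma> 1 (p + 1) = pick Ys \<sigma> 1 (p + 1)" for Z
    using Ys q by (intro pick_append[OF perm]) auto
  have 2: "pick (Ys @ [v]) \<sigma> (p + 1) (p + q + 1) = pick Ys \<sigma> (p + 1) (p + q) @ [v]" for v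
    using pick_append[OF perm, of Ys "p + 1" "p + q" "[v]"] q Ys top
      pick_Suc[of "p + 1" "p + q" "Ys @ [v]" \<sigma>] by (simp add: nth_append)
  show ?thesis
    unfolding 1 2
    by (rule lts_symmetric_lin[OF cochains_lin[OF P, of "pick Ys \<sigma> 1 (p + 1)"]
        LTS_cochains_symmetric[OF Q, of "pick Ys \<sigma> (p + 1) (p + q)"]]) (use q in auto)
qed

text \<open>
  The terms of \<open>P \<circ>\<^sub>p Q\<close>, together with the terms of \<open>P \<circ>\<^sub>p\<^sub>+\<^sub>1 Q\<close> whose shuffle moves the last
  argument into \<open>P\<close>, let \<open>Q\<close> act as a derivation on the last three arguments of \<open>P\<close>.
\<close>

lemma lts_symmetric_derivation_part:
  fixes p q :: nat
  assumes P: "P \<in> LTS_cochains scale (Suc p)" and Ys: "p + q = length Ys"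
  shows "lts_symmetric (\<lambda>x y z.
      scale ((-1) ^ (p * q)) (circ_at scale (Suc p) q (Suc p) P Q (Ys @ [(x, y)]) z) +
      scale ((-1) ^ (Suc p * q)) (\<Sum>\<sigma> | \<sigma> \<in> shuffle_perms (Suc p) q \<and> \<sigma> (Suc p) = Suc p + q.
        scale (of_int (sign \<sigma>)) (P (pick (Ys @ [(x, y)]) \<sigma> 1 (Suc p + 1))
          (Q (pick (Ys @ [(x, y)]) \<sigma> (Suc p + 1) (Suc p + q + 1)) z))))"
proof -
  have P': "P \<in> cochains scale (Suc p)" using P by (simp add: LTS_cochains_iff)
  define c where "c = shift_cycle (Suc p) q"
  define A where "A \<tau> = pick Ys \<tau> 1 (Suc p)" for \<tau>
  \<comment> \<open>With the shuffled pairs frozen, \<open>Q\<close> becomes the unary map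
    \<open>h \<tau>\<close> and \<open>P\<close> the ternary map \<open>T \<tau>\<close>.\<close>
  define h where "h \<tau> = Q (pick Ys \<tau> (Suc p) (Suc p + q))" for \<tau>
  define T where "T \<tau> x y z = P (A \<tau> @ [(x, y)]) z" for \<tau> x y z
  define S where "S = {\<sigma> \<in> shuffle_perms (Suc p) q. \<sigma> (Suc p) = Suc p + q}"
  have A: "pick (Ys @ Z) \<tau> 1 (Suc p) = A \<tau>"
    and B: "pick (Ys @ Z) \<tau> (Suc p) (Suc p + q) = pick Ys \<tau> (Suc p) (Suc p + q)"
    if "\<tau> \<in> shuffle_perms p q" for \<tau> Z
    unfolding A_def using Ys by (auto intro!: pick_append[OF shuffle_perms_permutes[OF that]])
  have inner: "circ_at scale (Suc p) q (Suc p) P Q (Ys @ [(x, y)]) z =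
     (\<Sum>\<tau>\<in>shuffle_perms p q. scale (of_int (sign \<tau>)) (T \<tau> (h \<tau> x) y z + T \<tau> x (h \<tau> y) z))" for x y z
  proof -
    have "(Ys @ [v]) ! (Suc p + q - 1) = v" "drop (Suc p + q) (Ys @ [v]) = []" for v
      using Ys by simp_all
    then show ?thesis
      by (subst circ_at_inner, simp, intro sum.cong)
        (simp_all only: diff_Suc_1 A B T_def h_def apfst_conv apsnd_conv)
  qed
  have cA: "pick (Ys @ [v]) (\<tau> \<circ> c) 1 (Suc p + 1) = A \<tau> @ [v]"
    and cB: "pick (Ys @ [v]) (\<tau> \<circ> c) (Suc p + 1) (Suc p + q + 1) = pick Ys \<tau> (Suc p) (Suc p + q)"
    if \<tau>: "\<tau> \<in> shuffle_perms p q" for \<tau> v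
  proof -
    have "pick (Ys @ [v]) (\<tau> \<circ> c) 1 (Suc p) = pick (Ys @ [v]) \<tau> 1 (Suc p)"
      by (rule pick_cong) (simp add: c_def shift_cycle_def)
    moreover have "\<tau> (Suc (p + q)) = Suc (p + q)"
      using shuffle_perms_permutes[OF \<tau>] by (simp add: permutes_def)
    ultimately show "pick (Ys @ [v]) (\<tau> \<circ> c) 1 (Suc p + 1) = A \<tau> @ [v]"
      using pick_Suc[of 1 "Suc p" "Ys @ [v]" "\<tau> \<circ> c"] A[OF \<tau>] Ys
      by (simp add: c_def shift_cycle_def)
    have "pick (Ys @ [v]) (\<tau> \<circ> c) (Suc p + 1) (Suc p + q + 1) = pick (Ys @ [v]) \<tau> (Suc p) (Suc p + q)"
      unfolding add_Suc_right add_0_right One_nat_def pick_Suc_Suc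
      by (rule pick_cong) (simp add: c_def shift_cycle_def)
    then show "pick (Ys @ [v]) (\<tau> \<circ> c) (Suc p + 1) (Suc p + q + 1) = pick Ys \<tau> (Suc p) (Suc p + q)"
      using B[OF \<tau>] by simp
  qed
  \<comment> \<open>Each shuffle in \<open>S\<close> is \<open>\<tau> \<circ> c\<close> for exactly
    one \<open>\<tau>\<close>, so these terms get the same index set as the inner ones.\<close>
  have "(\<Sum>\<sigma>\<in>S. scale (of_int (sign \<sigma>)) (P (pick (Ys @ [(x, y)]) \<sigma> 1 (Suc p + 1))
          (Q (pick (Ys @ [(x, y)]) \<sigma> (Suc p + 1) (Suc p + q + 1)) z))) =
     (\<Sum>\<tau>\<in>shuffle_perms p q. scale (of_int (sign (\<tau> \<circ> c))) (P (pick (Ys @ [(x, y)]) (\<tau> \<circ> c) 1 (Suc p + 1))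
          (Q (pick (Ys @ [(x, y)]) (\<tau> \<circ> c) (Suc p + 1) (Suc p + q + 1)) z)))" for x y z
    using bij_betw_shuffle_perms[of p q]
    by (intro sum.reindex_bij_betw[symmetric]) (simp add: S_def c_def)
  also have "\<dots> x y z =
     (\<Sum>\<tau>\<in>shuffle_perms p q. scale ((-1) ^ q) (scale (of_int (sign \<tau>)) (T \<tau> x y (h \<tau> z))))" for x y z
  proof (rule sum.cong[OF refl])
    fix \<tau> assume \<tau>: "\<tau> \<in> shuffle_perms p q"
    have sgn: "of_int (sign (\<tau> \<circ> c)) = ((-1) ^ q * of_int (sign \<tau>) :: 'f)"
      using sign_comp_shift_cycle[OF \<tau>] by (simp add: c_def)
    show "scale (of_int (sign (\<tau> \<circ> c))) (P (pick (Ys @ [(x, y)]) (\<tau> \<circ> c) 1 (Suc p + 1))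
          (Q (pick (Ys @ [(x, y)]) (\<tau> \<circ> c) (Suc p + 1) (Suc p + q + 1)) z)) =
        scale ((-1) ^ q) (scale (of_int (sign \<tau>)) (T \<tau> x y (h \<tau> z)))"
      by (simp only: cA[OF \<tau>] cB[OF \<tau>] sgn T_def h_def scale_scale)
  qed
  finally have outer: "(\<Sum>\<sigma>\<in>S. scale (of_int (sign \<sigma>)) (P (pick (Ys @ [(x, y)]) \<sigma> 1 (Suc p + 1))
          (Q (pick (Ys @ [(x, y)]) \<sigma> (Suc p + 1) (Suc p + q + 1)) z))) =
     scale ((-1) ^ q) (\<Sum>\<tau>\<in>shuffle_perms p q. scale (of_int (sign \<tau>)) (T \<tau> x y (h \<tau> z)))" for x y z
    by (simp add: scale_sum_right)
  \<comment> \<open>The sign of the cycle compensates the difference between the signs of positions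
    \<open>p + 1\<close> and \<open>p + 2\<close>, so all three derivation terms carry the same
    sign.\<close>
  have "(-1) ^ (Suc p * q) * (-1) ^ q = ((-1) ^ (p * q) :: 'f)"
    by (cases "even q") (simp_all add: power_add)
  then have iff: "lts_symmetric (\<lambda>x y z.
      scale ((-1) ^ (p * q)) (circ_at scale (Suc p) q (Suc p) P Q (Ys @ [(x, y)]) z) +
      scale ((-1) ^ (Suc p * q)) (\<Sum>\<sigma>\<in>S.
        scale (of_int (sign \<sigma>)) (P (pick (Ys @ [(x, y)]) \<sigma> 1 (Suc p + 1))
          (Q (pick (Ys @ [(x, y)]) \<sigma> (Suc p + 1) (Suc p + q + 1)) z)))) \<longleftrightarrow>
    lts_symmetric (\<lambda>x y z. scale ((-1) ^ (p * q)) (\<Sum>\<tau>\<in>shuffle_perms p q.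
      scale (of_int (sign \<tau>)) (T \<tau> (h \<tau> x) y z + T \<tau> x (h \<tau> y) z + T \<tau> x y (h \<tau> z))))"
    unfolding inner outer scale_scale by (simp only: scale_right_distrib sum.distrib)
  have "lts_symmetric (\<lambda>x y z. T \<tau> (h \<tau> x) y z + T \<tau> x (h \<tau> y) z + T \<tau> x y (h \<tau> z))" for \<tau>
  proof (rule lts_symmetric_derivation)
    show "lts_symmetric (T \<tau>)"
      unfolding T_def by (rule LTS_cochains_symmetric[OF P]) (simp add: A_def)
    show "T \<tau> (x + x') y z = T \<tau> x y z + T \<tau> x' y z" "T \<tau> x (y + y') z = T \<tau> x y z + T \<tau> x y' z" for x x' y y' z
      using lin_add[OF cochains_lin_middle[OF P' _ slots_fst, of "A \<tau>" "[]"]]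
        lin_add[OF cochains_lin_middle[OF P' _ slots_snd, of "A \<tau>" "[]"]]
      by (auto simp: T_def A_def)
  qed
  then have "lts_symmetric (\<lambda>x y z. scale ((-1) ^ (p * q)) (\<Sum>\<tau>\<in>shuffle_perms p q.
      scale (of_int (sign \<tau>)) (T \<tau> (h \<tau> x) y z + T \<tau> x (h \<tau> y) z + T \<tau> x y (h \<tau> z))))"
    by (intro lts_symmetric_scale lts_symmetric_sum)
  with iff show ?thesis
    unfolding S_def by (rule iffD2)
qed

lemma circ_in_LTS_cochains:
  assumes P: "P \<in> LTS_cochains scale p" and Q: "Q \<in> LTS_cochains scale q"
  shows "circ scale p q P Q \<in> LTS_cochains scale (p + q)"
  unfolding LTS_cochains_iff
proof (intro conjI allI impI)
  have P': "P \<in> cochains scale p" and Q': "Q \<in> cochains scale q"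
    using P Q by (auto simp: LTS_cochains_iff)
  then show "circ scale p q P Q \<in> cochains scale (p + q)"
    by (rule circ_in_cochains)
  fix Ys :: "('v \<times> 'v) list"
  assume Ys: "p + q = Suc (length Ys)"
  define F where "F \<sigma> x y z = scale (of_int (sign \<sigma>)) (P (pick (Ys @ [(x, y)]) \<sigma> 1 (p + 1))
          (Q (pick (Ys @ [(x, y)]) \<sigma> (p + 1) (p + q + 1)) z))" for \<sigma> x y z
  define S where "S = shuffle_perms p q"
  have split: "(\<Sum>\<sigma>\<in>S. F \<sigma> x y z) =
      (\<Sum>\<sigma> | \<sigma> \<in> S \<and> \<sigma> p = p + q. F \<sigma> x y z) + (\<Sum>\<sigma> | \<sigma> \<in> S \<and> \<sigma> p \<noteq> p + q. F \<sigma> x y z)" for x y z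
    unfolding S_def
    by (subst sum.union_disjoint[symmetric]) (auto simp: finite_shuffle_perms intro!: sum.cong)
  have rest: "lts_symmetric (\<lambda>x y z. scale c (\<Sum>\<sigma> | \<sigma> \<in> S \<and> \<sigma> p \<noteq> p + q. F \<sigma> x y z))" for c
    unfolding F_def S_def
    by (intro lts_symmetric_scale lts_symmetric_sum lts_symmetric_circ_at_outer[OF P' Q Ys]) auto
  show "lts_symmetric (\<lambda>x y z. circ scale p q P Q (Ys @ [(x, y)]) z)"
  proof (cases p)
    case 0
    \<comment> \<open>Position 0 lies outside the permuted set and is fixed, whereas
      \<open>q\<close> is positive because the argument list is nonempty.\<close>
    have "\<sigma> p \<noteq> p + q" if "\<sigma> \<in> S" for \<sigma>
      using shuffle_perms_permutes[of \<sigma> p q] that 0 Ys by (simp add: S_def permutes_def)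
    then have "{\<sigma> \<in> S. \<sigma> p = p + q} = {}" by auto
    then have "(\<Sum>\<sigma>\<in>S. F \<sigma> x y z) = (\<Sum>\<sigma> | \<sigma> \<in> S \<and> \<sigma> p \<noteq> p + q. F \<sigma> x y z)" for x y z
      unfolding split by (simp only: sum.empty add_0)
    moreover have "circ scale p q P Q (Ys @ [(x, y)]) z = (\<Sum>\<sigma>\<in>S. F \<sigma> x y z)" for x y z
      using Ys 0 by (simp add: circ_def circ_at_outer F_def S_def)
    ultimately have eq: "circ scale p q P Q (Ys @ [(x, y)]) z =
        scale 1 (\<Sum>\<sigma> | \<sigma> \<in> S \<and> \<sigma> p \<noteq> p + q. F \<sigma> x y z)" for x y z
      by simp
    show ?thesis unfolding eq by (rule rest)
  next
    case (Suc p')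
    \<comment> \<open>Three groups: positions below \<open>p\<close>; position \<open>p\<close> with
      the outer shuffles that give \<open>P\<close> the last pair; the outer shuffles that leave it
      to \<open>Q\<close>.\<close>
    have eq: "circ scale p q P Q (Ys @ [(x, y)]) z =
      (\<Sum>k = 1..p'. scale ((-1) ^ ((k - 1) * q)) (circ_at scale p q k P Q (Ys @ [(x, y)]) z)) +
      (scale ((-1) ^ (p' * q)) (circ_at scale p q p P Q (Ys @ [(x, y)]) z) +
       scale ((-1) ^ (p * q)) (\<Sum>\<sigma> | \<sigma> \<in> S \<and> \<sigma> p = p + q. F \<sigma> x y z)) +
      scale ((-1) ^ (p * q)) (\<Sum>\<sigma> | \<sigma> \<in> S \<and> \<sigma> p \<noteq> p + q. F \<sigma> x y z)" for x y z
    proof -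
      have "circ_at scale p q (Suc p) P Q (Ys @ [(x, y)]) z = (\<Sum>\<sigma>\<in>S. F \<sigma> x y z)"
        unfolding circ_at_outer F_def S_def ..
      then show ?thesis
        unfolding circ_def using Ys Suc by (simp add: split scale_right_distrib add.assoc)
    qed
    have early: "lts_symmetric (\<lambda>x y z. \<Sum>k = 1..p'. scale ((-1) ^ ((k - 1) * q))
        (circ_at scale p q k P Q (Ys @ [(x, y)]) z))"
      using Suc by (intro lts_symmetric_sum lts_symmetric_scale lts_symmetric_circ_at_inner[OF P _ _ Ys]) auto
    have late: "lts_symmetric (\<lambda>x y z.
        scale ((-1) ^ (p' * q)) (circ_at scale p q p P Q (Ys @ [(x, y)]) z) +
        scale ((-1) ^ (p * q)) (\<Sum>\<sigma> | \<sigma> \<in> S \<and> \<sigma> p = p + q. F \<sigma> x y z))"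
      using P Ys unfolding F_def S_def Suc by (intro lts_symmetric_derivation_part) simp_all
    show ?thesis
      unfolding eq by (rule lts_symmetric_plus[OF lts_symmetric_plus[OF early late] rest])
  qed
qed

section \<open>The graded Lie subalgebra\<close>

lemma vector_space_cscale: "vector_space (cscale scale)"
  by unfold_locales (auto simp: cscale_def fun_eq_iff scale_right_distrib scale_left_distrib)

lemma subspace_LTS_cochains: "module.subspace (cscale scale) (LTS_cochains scale p)"
proof -
  interpret C: vector_space "cscale scale" by (rule vector_space_cscale)
  show ?thesis
  proof (rule C.subspaceI)
    show "0 \<in> LTS_cochains scale p"
      by (auto simp: LTS_cochains_iff cochains_def lin_const_zero lts_symmetric_zero zero_fun_def)
    show "P + Q \<in> LTS_cochains scale p" if "P \<in> LTS_cochains scale p" "Q \<in> LTS_cochains scale p" for P Q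
      using that by (auto simp: LTS_cochains_iff cochains_def lin_plus lts_symmetric_plus plus_fun_def)
    show "cscale scale c P \<in> LTS_cochains scale p" if "P \<in> LTS_cochains scale p" for c P
      using that by (auto simp: LTS_cochains_iff cochains_def lin_scale lts_symmetric_scale cscale_def)
  qed
qed

lemma graded_lie_subalgebra_LTS_cochains:
  "graded_lie_subalgebra (cscale scale) (cochains scale) (bracket scale) (LTS_cochains scale)"
proof -
  interpret C: vector_space "cscale scale" by (rule vector_space_cscale)
  have "bracket scale p q P Q \<in> LTS_cochains scale (p + q)"
    if "P \<in> LTS_cochains scale p" "Q \<in> LTS_cochains scale q" for p q P Q
    unfolding bracket_def
    using circ_in_LTS_cochains[OF that] circ_in_LTS_cochains[OF that(2,1)] subspace_LTS_cochains
    by (intro C.subspace_diff C.subspace_scale) (auto simp: add.commute)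
  then show ?thesis
    using subspace_LTS_cochains by (auto simp: graded_lie_subalgebra_def LTS_cochains_def)
qed

section \<open>Degree one and Maurer-Cartan elements\<close>

lemma shuffle_perms_0_1: "shuffle_perms 0 (Suc 0) = {id}"
  by (auto simp: shuffle_perms_def permutes_sing strict_mono_on_def)

lemma shuffle_perms_1_1: "shuffle_perms (Suc 0) (Suc 0) = {id, transpose 1 2}"
proof -
  have "{1..Suc 0 + Suc 0} = {1, 2::nat}" by auto
  then show ?thesis
    by (auto simp: shuffle_perms_def permutes_doubleton_iff strict_mono_on_def)
qed

text \<open>Position 1 admits only the identity shuffle. Position 2 carries the sign -1 and admits
  the identity and the transposition, which has sign -1 itself.\<close>

lemma circ_1_1: "circ scale 1 1 P P [(x1, y1), (x2, y2)] x =
    P [(P [(x1, y1)] x2, y2)] x + P [(x2, P [(x1, y1)] y2)] x -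
    (P [(x1, y1)] (P [(x2, y2)] x) - P [(x2, y2)] (P [(x1, y1)] x))"
proof -
  have "(id :: nat \<Rightarrow> nat) \<noteq> transpose 1 2" by (auto simp: fun_eq_iff transpose_def)
  moreover have "sign (transpose 1 (2::nat)) = -1" by (simp add: sign_swap_id)
  ultimately show ?thesis
    by (simp add: circ_def circ_at_def shuffle_perms_0_1 shuffle_perms_1_1 pick_def numeral_2_eq_2 upt_rec)
qed

text \<open>In degrees \<open>p = q = 1\<close> the sign \<open>(-1) ^ (p * q)\<close> is -1, so the
  two compositions add up.\<close>

lemma bracket_1_1: "bracket scale 1 1 P P Xs x = scale 2 (circ scale 1 1 P P Xs x)"
proof -
  have "scale 2 (circ scale 1 1 P P Xs x) = scale (1 + 1) (circ scale 1 1 P P Xs x)" by simp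
  also have "\<dots> = circ scale 1 1 P P Xs x + circ scale 1 1 P P Xs x"
    unfolding scale_left_distrib by simp
  finally show ?thesis by (simp add: bracket_def cscale_def)
qed

text \<open>As 2 is invertible, the bracket vanishes exactly when \<open>circ\<close> does. Only
  lists of two pairs matter, since \<open>circ\<close> is 0 on all others.\<close>

lemma bracket_1_1_eq_0_iff:
  assumes "(2::'f) \<noteq> 0"
  shows "bracket scale 1 1 P P = 0 \<longleftrightarrow> (\<forall>x y z w u. P [(x, y)] (P [(z, w)] u) =
    P [(P [(x, y)] z, w)] u + P [(z, P [(x, y)] w)] u + P [(z, w)] (P [(x, y)] u))"
proof -
  have "bracket scale 1 1 P P = 0 \<longleftrightarrow> (\<forall>Xs x. circ scale 1 1 P P Xs x = 0)"
    using assms by (simp only: fun_eq_iff bracket_1_1) simp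
  also have "\<dots> \<longleftrightarrow> (\<forall>x y z w u. circ scale 1 1 P P [(x, y), (z, w)] u = 0)"
  proof (intro iffI allI)
    fix Xs x
    assume *: "\<forall>x y z w u. circ scale 1 1 P P [(x, y), (z, w)] u = 0"
    show "circ scale 1 1 P P Xs x = 0"
    proof (cases "length Xs = 2")
      case True
      then obtain a b where "Xs = [a, b]"
        by (auto simp: numeral_2_eq_2 length_Suc_conv)
      then show ?thesis using * by (cases a; cases b) blast
    qed (simp add: circ_def)
  qed blast
  finally have "bracket scale 1 1 P P = 0 \<longleftrightarrow>
    (\<forall>x y z w u. circ scale 1 1 P P [(x, y), (z, w)] u = 0)" .
  moreover have "circ scale 1 1 P P [(x, y), (z, w)] u = 0 \<longleftrightarrow> P [(x, y)] (P [(z, w)] u) =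
      P [(P [(x, y)] z, w)] u + P [(z, P [(x, y)] w)] u + P [(z, w)] (P [(x, y)] u)" for x y z w u
    unfolding circ_1_1 by (auto simp: algebra_simps)
  ultimately show ?thesis by (simp only:)
qed

lemma LTS_cochains_1_iff: "P \<in> LTS_cochains scale 1 \<longleftrightarrow>
    (\<forall>y z. lin (\<lambda>x. P [(x, y)] z)) \<and> (\<forall>x z. lin (\<lambda>y. P [(x, y)] z)) \<and> (\<forall>x y. lin (P [(x, y)])) \<and>
    (\<forall>Xs x. length Xs \<noteq> 1 \<longrightarrow> P Xs x = 0) \<and> lts_symmetric (\<lambda>x y z. P [(x, y)] z)"
    (is "_ \<longleftrightarrow> ?R")
proof
  assume P: "P \<in> LTS_cochains scale 1"
  then have P': "P \<in> cochains scale 1" by (simp add: LTS_cochains_iff)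
  show ?R
    using cochains_lin_middle[OF P' _ slots_fst, of "[]" "[]"] cochains_lin_middle[OF P' _ slots_snd, of "[]" "[]"]
      cochains_lin[OF P'] cochains_outside[OF P'] LTS_cochains_symmetric[OF P, of "[]"]
    by simp
next
  assume ?R
  then show "P \<in> LTS_cochains scale 1"
    by (auto simp: LTS_cochains_iff cochains_def length_Suc_conv)
qed

lemma maurer_cartan_LTS_cochains_iff:
  assumes "(2::'f) \<noteq> 0"
  shows "P \<in> maurer_cartan (LTS_cochains scale) (bracket scale) \<longleftrightarrow>
    (\<forall>Xs x. length Xs \<noteq> 1 \<longrightarrow> P Xs x = 0) \<and> lie_triple_system scale (\<lambda>x y z. P [(x, y)] z)"
  unfolding maurer_cartan_def mem_Collect_eq bracket_1_1_eq_0_iff[OF assms] LTS_cochains_1_iff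
    lie_triple_system_def lts_symmetric_def
  by (simp only: conj_ac)

lemma bij_betw_maurer_cartan:
  assumes "(2::'f) \<noteq> 0"
  shows "bij_betw (\<lambda>\<pi> x y z. \<pi> [(x, y)] z)
    (maurer_cartan (LTS_cochains scale) (bracket scale)) {t. lie_triple_system scale t}"
\<comment> \<open>The inverse extends a ternary map by 0 to lists of length other than 1, the
  default value built into \<open>cochains\<close>.\<close>
proof (rule bij_betw_byWitness[where
      f' = "\<lambda>t Xs z. if length Xs = 1 then t (fst (hd Xs)) (snd (hd Xs)) z else 0"])
  let ?M = "maurer_cartan (LTS_cochains scale) (bracket scale)"
  show "\<forall>\<pi>\<in>?M. (\<lambda>Xs z. if length Xs = 1 then \<pi> [(fst (hd Xs), snd (hd Xs))] z else 0) = \<pi>"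
  proof (intro ballI ext)
    fix \<pi> Xs z assume "\<pi> \<in> ?M"
    then have "\<pi> \<in> cochains scale 1" by (simp add: maurer_cartan_def LTS_cochains_iff)
    then show "(if length Xs = 1 then \<pi> [(fst (hd Xs), snd (hd Xs))] z else 0) = \<pi> Xs z"
      using cochains_outside[of \<pi> 1 Xs z] by (auto simp: length_Suc_conv)
  qed
  show "(\<lambda>\<pi> x y z. \<pi> [(x, y)] z) ` ?M \<subseteq> {t. lie_triple_system scale t}"
    by (auto simp: maurer_cartan_LTS_cochains_iff[OF assms])
  show "(\<lambda>t Xs z. if length Xs = 1 then t (fst (hd Xs)) (snd (hd Xs)) z else 0) `
      {t. lie_triple_system scale t} \<subseteq> ?M"
    by (auto simp: maurer_cartan_LTS_cochains_iff[OF assms])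
qed auto

end

text \<open>In characteristic 2 the bracket of a degree-one cochain with itself is always 0, hence
  the condition on the Maurer-Cartan part. The bijection evaluates a cochain on one pair and one
  vector, translating the list encoding into ternary maps.\<close>

theorem theorem2p5:
  fixes s :: "'f::field \<Rightarrow> 'v::ab_group_add \<Rightarrow> 'v"
  assumes "vector_space s"
  shows "graded_lie_subalgebra (cscale s) (cochains s) (bracket s) (LTS_cochains s) \<and>
         ((2::'f) \<noteq> 0 \<longrightarrow>
           bij_betw (\<lambda>\<pi> x y z. \<pi> [(x, y)] z)
             (maurer_cartan (LTS_cochains s) (bracket s))
             {t. lie_triple_system s t})"
proof -
  interpret cochain_space s using assms by (rule cochain_space.intro)
  show ?thesis
    using graded_lie_subalgebra_LTS_cochains bij_betw_maurer_cartan by blast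
qed

end
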